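(* (i) If $\phi$ is the Laplace transform of a probability distribution on $[0,\infty)$, then $P(s)=\phi(1-s)$, $0<s<1$, is a probability generating function. (ii) Conversely, if $P$ is a probability generating function and $P(1-s)$ is completely monotone for all $s>0$, then $\phi(s)=P(1-s)$, $s>0$, is the Laplace transform of a probability distribution on $[0,\infty)$.
   Context: A Laplace transform (LT) is $\phi(s)=\int_{[0,\infty)}e^{-sx}\,d\mu(x)$ for a probability measure $\mu$ on $[0,\infty)$. A probability generating function (PGF) is $P(s)=\sum_{k\ge 0}p_k s^k$ with $p_k\ge 0$, $\sum_k p_k=1$; a function on $0<s<1$ is called a PGF if it agrees there with such a series. A function $f$ on $(0,\infty)$ is completely monotone if it is infinitely differentiable with $(-1)^n f^{(n)}(s)\ge 0$ for all $n\ge 0$, $s>0$. In (ii), the hypothesis that $P(1-s)$ is completely monotone for all $s>0$ means that the function $s\mapsto P(1-s)$, initially defined for $0<s<1$, extends to a completely monotone function on $(0,\infty)$ (such an extension is unique), and $P(1-s)$ denotes this extension. *)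

theory Defs
  imports "HOL-Probability.Probability"
begin

definition nonneg_distribution :: "real measure \<Rightarrow> bool" where
  "nonneg_distribution M \<longleftrightarrow> real_distribution M \<and> measure M {0..} = 1"

definition laplace_transform :: "real measure \<Rightarrow> real \<Rightarrow> real" where
  "laplace_transform M s = (LINT x:{0..}|M. exp (- s * x))"

text \<open>
  Functions are considered on the open half-line only: the values of \<open>\<phi>\<close> at arguments
  \<open>s \<le> 0\<close> play no role.
\<close>

definition is_laplace_transform :: "(real \<Rightarrow> real) \<Rightarrow> bool" where
  "is_laplace_transform \<phi> \<longleftrightarrow>
     (\<exists>M. nonneg_distribution M \<and> (\<forall>s>0. \<phi> s = laplace_transform M s))"

text \<open>
  A function is called a probability generating function if it agrees with one on the open
  interval from 0 to 1; its values elsewhere are irrelevant.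
\<close>

definition is_pgf :: "(real \<Rightarrow> real) \<Rightarrow> bool" where
  "is_pgf P \<longleftrightarrow>
     (\<exists>p :: nat \<Rightarrow> real. (\<forall>k. p k \<ge> 0) \<and> p sums 1 \<and>
        (\<forall>s\<in>{0<..<1}. (\<lambda>k. p k * s ^ k) sums P s))"

text \<open>
  Since the half-line is open, the iterated derivatives at points \<open>s > 0\<close> depend only
  on the values of \<open>f\<close> on the half-line.
\<close>

definition completely_monotone :: "(real \<Rightarrow> real) \<Rightarrow> bool" where
  "completely_monotone f \<longleftrightarrow>
     (\<forall>n. \<forall>s>0. (deriv ^^ n) f field_differentiable (at s) \<and>
        (- 1) ^ n * (deriv ^^ n) f s \<ge> 0)"

end

theory Submission
  imports Defs "HOL-Real_Asymp.Real_Asymp"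
begin

text \<open>
  For (i), expand \<open>exp (s * x)\<close> in \<open>exp (- (1 - s) * x) = exp (- x) * exp (s * x)\<close> and integrate
  term by term.

  For (ii), \<open>t \<mapsto> \<phi> (a - t)\<close> has nonnegative derivatives on \<open>[0, a)\<close>, hence is the sum there of its
  Taylor series at 0, with coefficients \<open>c k \<ge> 0\<close>. Since \<open>\<phi>\<close> tends to 1 at 0, the weights
  \<open>c k * a ^ k\<close> sum to 1. Placing them at the points \<open>k / a\<close> gives a distribution with Laplace
  transform \<open>s \<mapsto> \<phi> (a * (1 - exp (- s / a)))\<close>. These distributions are tight as \<open>a \<rightarrow> \<infinity>\<close>, and
  any weak limit point has Laplace transform \<open>\<phi>\<close>.
\<close>

section \<open>Taylor series of absolutely monotone functions\<close>

context
  fixes a :: real and d :: "nat \<Rightarrow> real \<Rightarrow> real"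
  assumes deriv_d: "\<And>n t. 0 \<le> t \<Longrightarrow> t < a \<Longrightarrow> (d n has_real_derivative d (Suc n) t) (at t)"
    and d_nonneg: "\<And>n t. 0 \<le> t \<Longrightarrow> t < a \<Longrightarrow> 0 \<le> d n t"
begin

text \<open>The remainder at 0 of \<open>d m\<close> after \<open>N\<close> Taylor terms, where
  \<open>d m\<close> stands for the m-th derivative of \<open>d 0\<close>. Both indices vary because
  differentiation trades one for the other.\<close>

definition taylor_rem :: "nat \<Rightarrow> nat \<Rightarrow> real \<Rightarrow> real" where
  "taylor_rem N m t = d m t - (\<Sum>k<N. d (m + k) 0 / fact k * t ^ k)"

lemma taylor_rem_0 [simp]: "taylor_rem 0 m t = d m t"
  by (simp add: taylor_rem_def)

lemma taylor_rem_Suc_at_0 [simp]: "taylor_rem (Suc N) m 0 = 0"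
  by (simp add: taylor_rem_def sum.lessThan_Suc_shift)

text \<open>Differentiation kills the constant term of the Taylor polynomial and shifts the others
  down. This recursion drives the inductions on \<open>N\<close> below.\<close>

lemma deriv_taylor_rem:
  assumes "0 \<le> t" "t < a"
  shows "(taylor_rem (Suc N) m has_real_derivative taylor_rem N (Suc m) t) (at t)"
proof -
  \<comment> \<open>The polynomial without its constant term \<open>d m 0\<close>, which is
    subtracted separately afterwards.\<close>
  have "((\<lambda>t. \<Sum>k<N. d (m + Suc k) 0 / fact (Suc k) * t ^ Suc k) has_real_derivative
         (\<Sum>k<N. d (Suc m + k) 0 / fact k * t ^ k)) (at t)"
  proof (rule DERIV_sum)
    fix k
    have "d (m + Suc k) 0 / fact (Suc k) * (real (Suc k) * t ^ k) = d (Suc m + k) 0 / fact k * t ^ k"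
      by (simp add: field_simps del: of_nat_Suc)
    then show "((\<lambda>t. d (m + Suc k) 0 / fact (Suc k) * t ^ Suc k) has_real_derivative
        d (Suc m + k) 0 / fact k * t ^ k) (at t)"
      using DERIV_cmult[OF DERIV_pow[of "Suc k" t], of "d (m + Suc k) 0 / fact (Suc k)"]
      by (simp only: diff_Suc_Suc diff_zero)
  qed
  from DERIV_diff[OF DERIV_diff[OF deriv_d[OF assms, of m] this] DERIV_const[of "d m 0"]]
  show ?thesis
    unfolding taylor_rem_def[abs_def]
    by (simp add: sum.lessThan_Suc_shift algebra_simps
        del: fact_Suc power_Suc sum.lessThan_Suc)
qed

text \<open>A remainder with at least one term removed vanishes at 0, and by induction its
  derivative is nonnegative.\<close>

lemma taylor_rem_nonneg:
  assumes "0 \<le> t" "t < a"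
  shows "0 \<le> taylor_rem N m t"
  using assms
proof (induction N arbitrary: m t)
  case 0
  then show ?case by (simp add: d_nonneg)
next
  case (Suc N)
  have "taylor_rem (Suc N) m 0 \<le> taylor_rem (Suc N) m t"
    by (rule DERIV_nonneg_imp_nondecreasing[OF Suc.prems(1)])
      (use deriv_taylor_rem Suc in \<open>meson order_le_less_trans\<close>)
  then show ?case by simp
qed

text \<open>With \<open>R\<close> the remainder on the left, this is the differential inequality
  \<open>(N + 1) * R t \<le> t * R' t\<close>. The difference of the two sides vanishes at 0. Its
  derivative is the same difference with \<open>N\<close> lowered and \<open>m\<close> raised, or
  \<open>t * d (Suc (Suc m)) t\<close> in the base case.\<close>

lemma taylor_rem_Suc_le:
  assumes "0 \<le> t" "t < a"
  shows "real (Suc N) * taylor_rem (Suc N) m t \<le> t * taylor_rem N (Suc m) t"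
  using assms
proof (induction N arbitrary: m t)
  case 0
  let ?h = "\<lambda>t. t * taylor_rem 0 (Suc m) t - 1 * taylor_rem (Suc 0) m t"
  have "?h 0 \<le> ?h t"
  proof (rule DERIV_nonneg_imp_nondecreasing[OF 0(1)])
    fix x assume x: "0 \<le> x" "x \<le> t"
    then have "(?h has_real_derivative x * d (Suc (Suc m)) x) (at x)"
      using 0
      by (auto intro!: derivative_eq_intros deriv_taylor_rem deriv_d)
    then show "\<exists>y. (?h has_real_derivative y) (at x) \<and> 0 \<le> y"
      using x 0 d_nonneg[of x] by (intro exI[of _ "x * d (Suc (Suc m)) x"]) auto
  qed
  then show ?case by simp
next
  case (Suc N)
  let ?h = "\<lambda>t. t * taylor_rem (Suc N) (Suc m) t - real (Suc (Suc N)) * taylor_rem (Suc (Suc N)) m t"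
  have "?h 0 \<le> ?h t"
  proof (rule DERIV_nonneg_imp_nondecreasing[OF Suc.prems(1)])
    fix x assume x: "0 \<le> x" "x \<le> t"
    let ?y = "x * taylor_rem N (Suc (Suc m)) x - real (Suc N) * taylor_rem (Suc N) (Suc m) x"
    have "(?h has_real_derivative ?y) (at x)"
      using x Suc.prems
      by (auto intro!: derivative_eq_intros deriv_taylor_rem simp: algebra_simps)
    then show "\<exists>y. (?h has_real_derivative y) (at x) \<and> 0 \<le> y"
      using Suc.IH[of x "Suc m"] x Suc.prems by (intro exI[of _ ?y]) auto
  qed
  then show ?case by simp
qed

text \<open>By the quotient rule, the sign of the derivative of this ratio is given by
  \<open>taylor_rem_Suc_le\<close>.\<close>

lemma taylor_rem_ratio_mono:
  assumes "0 < t" "t \<le> u" "u < a"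
  shows "taylor_rem (Suc N) m t / t ^ Suc N \<le> taylor_rem (Suc N) m u / u ^ Suc N"
proof (rule DERIV_nonneg_imp_nondecreasing[OF assms(2)])
  fix x assume x: "t \<le> x" "x \<le> u"
  \<comment> \<open>The quotient rule after cancelling the common factor
    \<open>x ^ N\<close>.\<close>
  let ?y = "(x * taylor_rem N (Suc m) x - real (Suc N) * taylor_rem (Suc N) m x) / x ^ Suc (Suc N)"
  have "(taylor_rem N (Suc m) x * x ^ Suc N - taylor_rem (Suc N) m x * (real (Suc N) * x ^ N)) /
      (x ^ Suc N * x ^ Suc N) = ?y"
    using x assms by (simp add: field_simps)
  then have "((\<lambda>x. taylor_rem (Suc N) m x / x ^ Suc N) has_real_derivative ?y) (at x)"
    using DERIV_divide[OF deriv_taylor_rem DERIV_pow[of "Suc N" x], of N m] x assms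
    by (simp del: power_Suc of_nat_Suc)
  moreover have "0 \<le> ?y"
    using taylor_rem_Suc_le[of x N m] x assms by simp
  ultimately show "\<exists>y. ((\<lambda>x. taylor_rem (Suc N) m x / x ^ Suc N) has_real_derivative y) (at x) \<and> 0 \<le> y"
    by blast
qed

text \<open>Monotonicity of the ratio compares the remainder at \<open>t\<close> with that at some
  \<open>u\<close> strictly between \<open>t\<close> and \<open>a\<close>. The remainder at
  \<open>u\<close> is bounded independently of \<open>N\<close>, so the one at \<open>t\<close>
  decays like \<open>(t / u) ^ N\<close>.\<close>

lemma absolutely_monotone_sums:
  assumes t: "0 \<le> t" "t < a"
  shows "(\<lambda>k. d k 0 / fact k * t ^ k) sums d 0 t"
proof (cases "t = 0")
  case True
  then show ?thesis
    using powser_sums_zero[of "\<lambda>k. d k 0 / fact k"] by simp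
next
  case False
  with t have "0 < t" by simp
  obtain u where u: "t < u" "u < a" using t dense by blast
  have bound: "norm (taylor_rem (Suc N) 0 t) \<le> (t / u) ^ Suc N * d 0 u" for N
  proof -
    \<comment> \<open>The Taylor polynomial at \<open>u\<close> has only nonnegative terms.\<close>
    have "taylor_rem (Suc N) 0 u \<le> d 0 u"
      using u t d_nonneg[of 0] by (auto simp: taylor_rem_def simp del: sum.lessThan_Suc intro!: sum_nonneg)
    then have "t ^ Suc N * (taylor_rem (Suc N) 0 u / u ^ Suc N) \<le> (t / u) ^ Suc N * d 0 u"
      using u t by (simp add: power_divide mult_left_mono divide_right_mono)
    moreover have "taylor_rem (Suc N) 0 t \<le> t ^ Suc N * (taylor_rem (Suc N) 0 u / u ^ Suc N)"
      using taylor_rem_ratio_mono[OF \<open>0 < t\<close> less_imp_le[OF u(1)] u(2), of N 0] \<open>0 < t\<close>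
      by (subst (asm) pos_divide_le_eq) (simp_all add: mult_ac)
    ultimately show ?thesis
      using taylor_rem_nonneg[OF t, of "Suc N" 0] by simp
  qed
  have "(\<lambda>N. (t / u) ^ Suc N * d 0 u) \<longlonglongrightarrow> 0"
    using LIMSEQ_realpow_zero[of "t / u"] u t
    by (intro tendsto_mult_left_zero LIMSEQ_Suc) auto
  then have "(\<lambda>N. taylor_rem (Suc N) 0 t) \<longlonglongrightarrow> 0"
    by (rule Lim_null_comparison[OF always_eventually[OF allI[OF bound]]])
  then have "(\<lambda>N. taylor_rem N 0 t) \<longlonglongrightarrow> 0"
    by (rule LIMSEQ_imp_Suc)
  from tendsto_diff[OF tendsto_const[of "d 0 t"] this] show ?thesis
    by (simp add: sums_def taylor_rem_def)
qed

text \<open>Nonnegative coefficients give a converse of Abel's theorem. Each partial sum at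
  \<open>a\<close> is a limit of partial sums at \<open>t < a\<close>, hence at most
  \<open>l\<close>; conversely \<open>d 0 t\<close> never exceeds the series at
  \<open>a\<close>.\<close>

lemma absolutely_monotone_sums_endpoint:
  assumes "0 < a" and lim: "(d 0 \<longlongrightarrow> l) (at_left a)"
  shows "(\<lambda>k. d k 0 / fact k * a ^ k) sums l"
proof -
  let ?c = "\<lambda>k. d k 0 / fact k"
  have ev: "\<forall>\<^sub>F t in at_left a. 0 \<le> t \<and> t < a"
    using eventually_at_left_real[OF \<open>0 < a\<close>] by eventually_elim auto
  have c: "0 \<le> ?c k" for k using d_nonneg[of 0 k] \<open>0 < a\<close> by simp
  have partial: "(\<Sum>k<N. ?c k * a ^ k) \<le> l" for N
  proof (rule tendsto_le[OF _ lim])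
    show "((\<lambda>t. \<Sum>k<N. ?c k * t ^ k) \<longlongrightarrow> (\<Sum>k<N. ?c k * a ^ k)) (at_left a)"
      by (intro tendsto_intros)
    show "\<forall>\<^sub>F t in at_left a. (\<Sum>k<N. ?c k * t ^ k) \<le> d 0 t"
      using ev
    proof eventually_elim
      case (elim t)
      then show ?case
        using absolutely_monotone_sums[of t] c
        by (metis (no_types, lifting) sums_unique sums_summable sum_le_suminf finite_lessThan
              mult_nonneg_nonneg zero_le_power)
    qed
  qed simp
  have s: "summable (\<lambda>k. ?c k * a ^ k)"
    by (intro summableI_nonneg_bounded[OF _ partial] mult_nonneg_nonneg c zero_le_power
          less_imp_le[OF \<open>0 < a\<close>])
  have "l \<le> (\<Sum>k. ?c k * a ^ k)"
  proof (rule tendsto_upperbound[OF lim])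
    show "\<forall>\<^sub>F t in at_left a. d 0 t \<le> (\<Sum>k. ?c k * a ^ k)"
      using ev
    proof eventually_elim
      case (elim t)
      then have "?c k * t ^ k \<le> ?c k * a ^ k" for k
        by (intro mult_left_mono power_mono c) auto
      with elim show ?case
        by (intro sums_le[OF _ absolutely_monotone_sums summable_sums[OF s]]) blast+
    qed
  qed simp
  moreover have "(\<Sum>k. ?c k * a ^ k) \<le> l"
    by (rule suminf_le_const[OF s]) (rule partial)
  ultimately show ?thesis using s by (simp add: sums_iff)
qed

end

section \<open>Laplace transforms\<close>

lemma nonneg_distribution_AE:
  assumes "nonneg_distribution M"
  shows "AE x in M. 0 \<le> x"
proof -
  interpret real_distribution M using assms by (simp add: nonneg_distribution_def)
  show ?thesis using AE_prob_1[of "{0..}"] assms by (simp add: nonneg_distribution_def)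
qed

text \<open>The truncation makes the integrand bounded and continuous on the whole line.\<close>

lemma laplace_transform_eq:
  assumes "nonneg_distribution M"
  shows "laplace_transform M s = (LINT x|M. exp (- s * max 0 x))"
proof -
  interpret real_distribution M using assms by (simp add: nonneg_distribution_def)
  show ?thesis
    unfolding laplace_transform_def set_lebesgue_integral_def
    using nonneg_distribution_AE[OF assms]
    by (intro integral_cong_AE) (auto elim!: eventually_mono)
qed

lemma integrable_exp_max:
  fixes s :: real
  assumes "real_distribution M" "0 \<le> s"
  shows "integrable M (\<lambda>x. exp (- s * max 0 x))"
proof -
  interpret real_distribution M by fact
  show ?thesis using assms(2) by (intro integrable_const_bound[where B = 1]) auto
qed

text \<open>The coefficients are Poisson probabilities with parameter mixed over \<open>M\<close>.
  All terms are nonnegative with partial sums at most 1, which justifies integrating term by term.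
  Including \<open>s = 1\<close> also yields the total mass of the coefficients.\<close>

lemma laplace_transform_poisson_sums:
  assumes M: "nonneg_distribution M" and s: "0 \<le> s" "s \<le> 1"
  shows "(\<lambda>k. (LINT x|M. exp (- max 0 x) * max 0 x ^ k / fact k) * s ^ k) sums
           (LINT x|M. exp (- (1 - s) * max 0 x))"
proof -
  interpret real_distribution M using M by (simp add: nonneg_distribution_def)
  let ?f = "\<lambda>k x. exp (- max 0 x) * max 0 x ^ k / fact k * s ^ k"
  have sums: "(\<lambda>k. ?f k x) sums exp (- (1 - s) * max 0 x)" for x
  proof -
    have "(\<lambda>k. exp (- max 0 x) * ((s * max 0 x) ^ k /\<^sub>R fact k)) sums
        (exp (- max 0 x) * exp (s * max 0 x))"
      by (intro sums_mult exp_converges)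
    then show ?thesis
      by (simp add: exp_add[symmetric] algebra_simps power_mult_distrib divide_inverse)
  qed
  have nonneg: "0 \<le> ?f k x" for k x using s by simp
  have norm_eq: "norm (?f k x) = ?f k x" for k x
    by (simp only: real_norm_def abs_of_nonneg[OF nonneg])
  have exp_le: "exp (- (1 - s) * max 0 x) \<le> 1" for x
    using s by (simp add: mult_nonpos_nonneg)
  have le1: "(\<Sum>k<n. ?f k x) \<le> 1" for n x
  proof -
    have "(\<Sum>k<n. ?f k x) \<le> (\<Sum>k. ?f k x)"
      by (rule sum_le_suminf[OF sums_summable[OF sums]]) (use nonneg in auto)
    also have "\<dots> \<le> 1"
      using sums_unique[OF sums, of x] exp_le[of x] by simp
    finally show ?thesis .
  qed
  have int: "integrable M (?f k)" for k
  proof (rule integrable_const_bound[where B = 1])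
    have "?f k x \<le> 1" for x
    proof -
      have "?f k x \<le> (\<Sum>j<Suc k. ?f j x)"
        by (rule member_le_sum) (use nonneg in auto)
      also have "\<dots> \<le> 1" by (rule le1)
      finally show ?thesis .
    qed
    then show "AE x in M. norm (?f k x) \<le> 1"
      by (intro AE_I2) (simp only: norm_eq)
  qed simp
  have "(\<lambda>k. LINT x|M. ?f k x) sums (LINT x|M. (\<Sum>k. ?f k x))"
  proof (rule sums_integral[OF int])
    show "AE x in M. summable (\<lambda>k. norm (?f k x))"
      by (intro AE_I2) (simp only: norm_eq sums_summable[OF sums])
    show "summable (\<lambda>k. LINT x|M. norm (?f k x))"
    proof (rule summableI_nonneg_bounded[where x = 1])
      fix n
      have "(\<Sum>k<n. LINT x|M. norm (?f k x)) = (LINT x|M. (\<Sum>k<n. ?f k x))"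
        using int by (simp only: norm_eq Bochner_Integration.integral_sum)
      also have "\<dots> \<le> 1"
        using le1 int by (intro integral_le_const AE_I2) auto
      finally show "(\<Sum>k<n. LINT x|M. norm (?f k x)) \<le> 1" .
    qed simp
  qed
  moreover have "(LINT x|M. ?f k x) = (LINT x|M. exp (- max 0 x) * max 0 x ^ k / fact k) * s ^ k" for k
    by simp
  ultimately show ?thesis using sums_unique[OF sums] by simp
qed

lemma is_pgf_laplace_transform:
  assumes "is_laplace_transform \<phi>"
  shows "is_pgf (\<lambda>s. \<phi> (1 - s))"
proof -
  obtain M where M: "nonneg_distribution M" and \<phi>: "\<And>s. 0 < s \<Longrightarrow> \<phi> s = laplace_transform M s"
    using assms by (auto simp: is_laplace_transform_def)
  interpret real_distribution M using M by (simp add: nonneg_distribution_def)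
  let ?p = "\<lambda>k. LINT x|M. exp (- max 0 x) * max 0 x ^ k / fact k"
  have "?p sums 1"
    using laplace_transform_poisson_sums[OF M, of 1] prob_space by simp
  moreover have "(\<lambda>k. ?p k * s ^ k) sums \<phi> (1 - s)" if "s \<in> {0<..<1}" for s
    using laplace_transform_poisson_sums[OF M, of s] \<phi>[of "1 - s"] that
    by (simp only: laplace_transform_eq[OF M]) simp
  moreover have "0 \<le> ?p k" for k by simp
  ultimately show ?thesis
    unfolding is_pgf_def by (intro exI[of _ ?p] conjI allI ballI)
qed

text \<open>The distribution is the image under \<open>y\<close> of the law on the naturals with
  weights \<open>p\<close>. The transform is given as a series so that it can be matched with a
  Taylor series.\<close>

lemma discrete_laplace_transform:
  fixes p y :: "nat \<Rightarrow> real"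
  assumes p: "\<And>k. 0 \<le> p k" "p sums 1" and y: "\<And>k. 0 \<le> y k"
  obtains M where "nonneg_distribution M"
    "\<And>s. 0 \<le> s \<Longrightarrow> (\<lambda>k. p k * exp (- s * y k)) sums laplace_transform M s"
proof -
  let ?D = "density (count_space UNIV) (\<lambda>k. ennreal (p k))"
  let ?M = "distr ?D borel y"
  have "emeasure ?D (space ?D) = (\<Sum>k. ennreal (p k))"
    by (simp add: emeasure_density nn_integral_count_space_nat)
  also have "\<dots> = 1"
    using p by (simp add: suminf_ennreal2 sums_iff)
  finally interpret D: prob_space ?D by (rule prob_spaceI)
  have [measurable]: "y \<in> borel_measurable ?D" by simp
  have "measure ?M {0..} = 1"
    using y D.prob_space by (subst measure_distr) (auto simp: vimage_def)
  then have M: "nonneg_distribution ?M"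
    by (simp add: nonneg_distribution_def)
  moreover have "(\<lambda>k. p k * exp (- s * y k)) sums laplace_transform ?M s" if "0 \<le> s" for s
  proof -
    have le: "norm (p k * exp (- s * y k)) \<le> p k" for k
      using p(1) y that by (simp add: abs_mult mult_left_le)
    have "summable (\<lambda>k. norm (p k * exp (- s * y k)))"
      by (rule summable_comparison_test'[OF sums_summable[OF p(2)]]) (use le in simp)
    then have "integrable (count_space UNIV) (\<lambda>k. p k * exp (- s * y k))"
      by (simp add: integrable_count_space_nat_iff)
    moreover have "laplace_transform ?M s = (LINT k|count_space UNIV. p k * exp (- s * y k))"
      using p(1) y
      by (simp add: laplace_transform_eq[OF M] integral_distr integral_density max_def)
    ultimately show ?thesis
      using sums_integral_count_space_nat by metis
  qed
  ultimately show thesis using that by blast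
qed

section \<open>Tail bounds and weak limits\<close>

text \<open>The integrand is at most 1 up to \<open>1 / s\<close> and at most
  \<open>exp (- 1)\<close> beyond, so a transform close to 1 forces mass into a bounded interval.
  The endpoint -1 keeps 0 inside the half-open interval that \<open>tight\<close> asks for.\<close>

lemma laplace_transform_tail:
  assumes M: "nonneg_distribution M" and s: "0 < s"
  shows "laplace_transform M s \<le> exp (- 1) + (1 - exp (- 1)) * measure M {-1<..1 / s}"
proof -
  interpret real_distribution M using M by (simp add: nonneg_distribution_def)
  let ?I = "\<lambda>x. indicator {-1<..1 / s} x :: real"
  have "(LINT x|M. exp (- s * max 0 x)) \<le> (LINT x|M. exp (- 1) + (1 - exp (- 1)) * ?I x)"
  proof (rule integral_mono_AE)
    show "integrable M (\<lambda>x. exp (- s * max 0 x))"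
      using integrable_exp_max[OF _ less_imp_le[OF s]] real_distribution_axioms by blast
    show "AE x in M. exp (- s * max 0 x) \<le> exp (- 1) + (1 - exp (- 1)) * ?I x"
      using nonneg_distribution_AE[OF M] s
      by (auto elim!: eventually_mono split: split_indicator simp: field_simps)
  qed (simp add: less_top[symmetric])
  then show ?thesis
    using prob_space by (simp add: laplace_transform_eq[OF M] less_top[symmetric])
qed

lemma nonneg_distribution_weak_limit:
  assumes \<mu>: "\<And>n. nonneg_distribution (\<mu> n)" and M: "real_distribution M" and w: "weak_conv_m \<mu> M"
  shows "nonneg_distribution M"
proof -
  interpret real_distribution M by fact
  \<comment> \<open>A bounded continuous test function that vanishes exactly on the nonnegative
    reals.\<close>
  let ?f = "\<lambda>x::real. min 1 (max 0 (- x))"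
  have \<mu>': "real_distribution (\<mu> n)" for n using \<mu> by (simp add: nonneg_distribution_def)
  have "(\<lambda>n. LINT x|\<mu> n. ?f x) \<longlonglongrightarrow> (LINT x|M. ?f x)"
    by (rule weak_conv_imp_integral_bdd_continuous_conv[OF \<mu>' M w, where B = 1])
      (auto intro!: continuous_intros)
  moreover have "(LINT x|\<mu> n. ?f x) = 0" for n
    using nonneg_distribution_AE[OF \<mu>, of n] by (intro integral_eq_zero_AE) (auto elim!: eventually_mono)
  ultimately have "(LINT x|M. ?f x) = 0"
    by (simp add: LIMSEQ_const_iff)
  moreover have "integrable M ?f"
    by (intro integrable_const_bound[where B = 1]) auto
  ultimately have "AE x in M. ?f x = 0"
    by (subst (asm) integral_nonneg_eq_0_iff_AE) auto
  then have "AE x in M. x \<in> {0..}"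
  proof eventually_elim
    case (elim x)
    then show ?case by (simp add: min_def max_def split: if_splits)
  qed
  then show ?thesis
    using M by (simp add: nonneg_distribution_def prob_eq_1)
qed

lemma laplace_transform_weak_limit:
  assumes \<mu>: "\<And>n. nonneg_distribution (\<mu> n)" and M: "real_distribution M" and w: "weak_conv_m \<mu> M"
    and s: "0 \<le> s"
  shows "(\<lambda>n. laplace_transform (\<mu> n) s) \<longlonglongrightarrow> laplace_transform M s"
proof -
  have \<mu>': "real_distribution (\<mu> n)" for n using \<mu> by (simp add: nonneg_distribution_def)
  have "(\<lambda>n. LINT x|\<mu> n. exp (- s * max 0 x)) \<longlonglongrightarrow> (LINT x|M. exp (- s * max 0 x))"
    by (rule weak_conv_imp_integral_bdd_continuous_conv[OF \<mu>' M w, where B = 1])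
      (use s in \<open>auto intro!: continuous_intros\<close>)
  then show ?thesis
    by (simp add: laplace_transform_eq \<mu> nonneg_distribution_weak_limit[OF \<mu> M w])
qed

section \<open>Bernstein's theorem\<close>

lemma completely_monotone_deriv:
  assumes "completely_monotone f" "0 < s"
  shows "((deriv ^^ n) f has_real_derivative (deriv ^^ Suc n) f s) (at s)"
  using assms by (simp add: completely_monotone_def DERIV_deriv_iff_field_differentiable)

lemma completely_monotone_antimono:
  assumes f: "completely_monotone f" and "0 < s" "s \<le> t"
  shows "f t \<le> f s"
proof (rule DERIV_nonpos_imp_nonincreasing[OF \<open>s \<le> t\<close>])
  fix x assume "s \<le> x" "x \<le> t"
  then have "0 < x" using \<open>0 < s\<close> by simp
  moreover have "0 \<le> (- 1) ^ 1 * (deriv ^^ 1) f x"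
    using f \<open>0 < x\<close> unfolding completely_monotone_def by blast
  ultimately show "\<exists>y. (f has_real_derivative y) (at x) \<and> y \<le> 0"
    using completely_monotone_deriv[OF f, of x 0] by auto
qed

lemma completely_monotone_discretization:
  fixes \<phi> :: "real \<Rightarrow> real"
  assumes cm: "completely_monotone \<phi>" and lim: "(\<phi> \<longlongrightarrow> 1) (at_right 0)" and a: "0 < a"
  obtains M where "nonneg_distribution M"
    "\<And>s. 0 < s \<Longrightarrow> laplace_transform M s = \<phi> (a * (1 - exp (- s / a)))"
proof -
  \<comment> \<open>The sign makes \<open>d n\<close> the n-th derivative of
    \<open>\<lambda>t. \<phi> (a - t)\<close>.\<close>
  define d where "d n t = (- 1) ^ n * (deriv ^^ n) \<phi> (a - t)" for n t
  have deriv_d: "(d n has_real_derivative d (Suc n) t) (at t)" if "0 \<le> t" "t < a" for n t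
  proof -
    have "((\<lambda>t. (deriv ^^ n) \<phi> (a - t)) has_real_derivative (deriv ^^ Suc n) \<phi> (a - t) * (- 1)) (at t)"
      using completely_monotone_deriv[OF cm, of "a - t" n] that
      by (intro DERIV_chain2[where f = "(deriv ^^ n) \<phi>"]) (auto intro!: derivative_eq_intros)
    from DERIV_cmult[OF this, of "(- 1) ^ n"] show ?thesis
      unfolding d_def[abs_def] by simp
  qed
  have d_nonneg: "0 \<le> d n t" if "0 \<le> t" "t < a" for n t
    using cm that by (simp add: d_def completely_monotone_def)
  have "filterlim (\<lambda>t. a - t) (at_right 0) (at_left a)"
    unfolding filterlim_at
    by (auto intro!: tendsto_eq_intros eventually_at_leftI[of 0] simp: a)
  then have "(d 0 \<longlongrightarrow> 1) (at_left a)"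
    unfolding d_def[abs_def] using filterlim_compose[OF lim] by simp
  note sums1 = absolutely_monotone_sums_endpoint[of a d, OF deriv_d d_nonneg a this]
  let ?p = "\<lambda>k. d k 0 / fact k * a ^ k"
  have "0 \<le> ?p k" for k using d_nonneg[of 0 k] a by simp
  then obtain M where M: "nonneg_distribution M"
    "\<And>s. 0 \<le> s \<Longrightarrow> (\<lambda>k. ?p k * exp (- s * (real k / a))) sums laplace_transform M s"
    using discrete_laplace_transform[of ?p "\<lambda>k. real k / a"] sums1 a by auto
  have "laplace_transform M s = \<phi> (a * (1 - exp (- s / a)))" if s: "0 < s" for s
  proof -
    \<comment> \<open>The factor \<open>exp (- s / a)\<close> is absorbed into the k-th power, so
      the transform is the Taylor series at \<open>a * exp (- s / a)\<close>, a point of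
      \<open>[0, a)\<close>.\<close>
    have "?p k * exp (- s * (real k / a)) = d k 0 / fact k * (a * exp (- s / a)) ^ k" for k
      by (simp add: power_mult_distrib exp_of_nat_mult[symmetric] mult_ac)
    moreover have "(\<lambda>k. d k 0 / fact k * (a * exp (- s / a)) ^ k) sums d 0 (a * exp (- s / a))"
      using a s by (intro absolutely_monotone_sums[of a d, OF deriv_d d_nonneg]) auto
    ultimately have "(\<lambda>k. ?p k * exp (- s * (real k / a))) sums d 0 (a * exp (- s / a))"
      by (simp only:)
    from sums_unique2[OF M(2)[OF less_imp_le[OF s]] this]
    have "laplace_transform M s = d 0 (a * exp (- s / a))" .
    then show ?thesis by (simp add: d_def right_diff_distrib)
  qed
  with M(1) show thesis by (rule that)
qed

theorem bernstein:
  assumes cm: "completely_monotone \<phi>" and lim: "(\<phi> \<longlongrightarrow> 1) (at_right 0)"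
  shows "is_laplace_transform \<phi>"
proof -
  let ?a = "\<lambda>n. real (Suc n)"
  let ?b = "\<lambda>s n. ?a n * (1 - exp (- s / ?a n))"
  have "\<exists>M. nonneg_distribution M \<and> (\<forall>s>0. laplace_transform M s = \<phi> (?b s n))" for n
  proof (rule completely_monotone_discretization[OF cm lim, of "?a n"])
    fix M
    assume "nonneg_distribution M" "\<And>s. 0 < s \<Longrightarrow> laplace_transform M s = \<phi> (?b s n)"
    then show ?thesis by blast
  qed simp
  then have "\<exists>\<mu>. \<forall>n. nonneg_distribution (\<mu> n) \<and> (\<forall>s>0. laplace_transform (\<mu> n) s = \<phi> (?b s n))"
    by (intro choice allI)
  then obtain \<mu> where \<mu>: "\<And>n. nonneg_distribution (\<mu> n)"
    and L\<mu>: "\<And>n s. 0 < s \<Longrightarrow> laplace_transform (\<mu> n) s = \<phi> (?b s n)" by blast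
  have "tight \<mu>"
    unfolding tight_def
  proof (intro conjI allI impI)
    show "real_distribution (\<mu> n)" for n using \<mu> by (simp add: nonneg_distribution_def)
    fix \<epsilon> :: real assume "0 < \<epsilon>"
    \<comment> \<open>The threshold at which \<open>laplace_transform_tail\<close> gives mass above
      \<open>1 - \<epsilon>\<close>.\<close>
    then have "1 - \<epsilon> * (1 - exp (- 1)) < 1" by simp
    from eventually_conj[OF order_tendstoD(1)[OF lim this] eventually_at_right_less]
    obtain s where s: "1 - \<epsilon> * (1 - exp (- 1)) < \<phi> s" "0 < s"
      using eventually_happens'[of "at_right (0::real)"] trivial_limit_at_right_real by fastforce
    have "1 - \<epsilon> < measure (\<mu> n) {-1<..1 / s}" for n
    proof -
      \<comment> \<open>Since \<open>\<phi>\<close> is antitone, this bounds all transforms at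
        \<open>s\<close> below by \<open>\<phi> s\<close>, so a single \<open>s\<close> serves every
        \<open>n\<close>.\<close>
      have "?b s n \<le> s"
        using exp_ge_add_one_self[of "- s / ?a n"] by (simp add: field_simps)
      moreover have "0 < ?b s n" using s by simp
      ultimately have "\<phi> s \<le> laplace_transform (\<mu> n) s"
        using completely_monotone_antimono[OF cm] L\<mu> s by simp
      with laplace_transform_tail[OF \<mu> s(2), of n] s(1)
      have "(1 - exp (- 1)) * (1 - \<epsilon>) < (1 - exp (- 1)) * measure (\<mu> n) {-1<..1 / s}"
        by (simp add: algebra_simps)
      then show ?thesis by (subst (asm) mult_less_cancel_left_pos) simp_all
    qed
    then show "\<exists>a b. a < b \<and> (\<forall>n. 1 - \<epsilon> < measure (\<mu> n) {a<..b})"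
      using s by (intro exI[of _ "-1"] exI[of _ "1 / s"]) (auto intro: less_trans[of _ 0])
  qed
  \<comment> \<open>Helly selection; the identity as first subsequence makes \<open>r\<close> a
    subsequence of \<open>\<mu>\<close> itself.\<close>
  from tight_imp_convergent_subsubsequence[OF this strict_mono_id]
  obtain r M where r: "strict_mono (r :: nat \<Rightarrow> nat)" and M: "real_distribution M"
    and w: "weak_conv_m (\<mu> \<circ> r) M" by (auto simp: comp_def id_def)
  have \<mu>r: "nonneg_distribution ((\<mu> \<circ> r) n)" for n using \<mu> by simp
  have "\<phi> s = laplace_transform M s" if s: "0 < s" for s
  proof (rule LIMSEQ_unique)
    show "(\<lambda>n. laplace_transform ((\<mu> \<circ> r) n) s) \<longlonglongrightarrow> laplace_transform M s"
      using s by (intro laplace_transform_weak_limit[OF \<mu>r M w]) simp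
    \<comment> \<open>The discretization error disappears: \<open>a * (1 - exp (- s / a))\<close>
      tends to \<open>s\<close> as \<open>a\<close> grows.\<close>
    have "?b s \<longlonglongrightarrow> s" by real_asymp
    moreover have "isCont \<phi> s"
      using DERIV_isCont completely_monotone_deriv[OF cm s, of 0] by simp
    ultimately have "(\<lambda>n. \<phi> (?b s n)) \<longlonglongrightarrow> \<phi> s"
      by (rule isCont_tendsto_compose[rotated])
    then have "(\<lambda>n. laplace_transform (\<mu> n) s) \<longlonglongrightarrow> \<phi> s"
      by (simp only: L\<mu>[OF s])
    from LIMSEQ_subseq_LIMSEQ[OF this r]
    show "(\<lambda>n. laplace_transform ((\<mu> \<circ> r) n) s) \<longlonglongrightarrow> \<phi> s"
      by (simp add: comp_def)
  qed
  with nonneg_distribution_weak_limit[OF \<mu>r M w] show ?thesis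
    by (auto simp: is_laplace_transform_def)
qed

section \<open>Generating functions near 1 and the two implications\<close>

text \<open>Supplies the normalisation required by \<open>bernstein\<close>. Finite partial sums,
  continuous at 1, bound \<open>P\<close> from below; termwise comparison with \<open>p\<close>
  bounds it above by 1.\<close>

lemma is_pgf_tendsto_1:
  assumes "is_pgf P"
  shows "(P \<longlongrightarrow> 1) (at_left 1)"
proof -
  obtain p where p: "\<And>k. 0 \<le> p k" "p sums 1"
    and P: "\<And>s. 0 < s \<Longrightarrow> s < 1 \<Longrightarrow> (\<lambda>k. p k * s ^ k) sums P s"
    using assms unfolding is_pgf_def Ball_def greaterThanLessThan_iff by blast
  have ev: "\<forall>\<^sub>F s in at_left 1. 0 < s \<and> s < (1::real)"
    using eventually_at_left_real[of 0 "1::real"] by (auto elim: eventually_mono)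
  show ?thesis
  proof (rule order_tendstoI)
    fix y :: real assume "y < 1"
    then have "\<forall>\<^sub>F n in sequentially. y < (\<Sum>k<n. p k)"
      using p(2) unfolding sums_def by (rule order_tendstoD(1)[rotated])
    then obtain n where n: "y < (\<Sum>k<n. p k)" by (auto simp: eventually_sequentially)
    have "((\<lambda>s. \<Sum>k<n. p k * s ^ k) \<longlongrightarrow> (\<Sum>k<n. p k * 1 ^ k)) (at_left 1)"
      by (intro tendsto_intros)
    then have "\<forall>\<^sub>F s in at_left 1. y < (\<Sum>k<n. p k * s ^ k)"
      using n by (intro order_tendstoD(1)) simp_all
    with ev show "\<forall>\<^sub>F s in at_left 1. y < P s"
    proof eventually_elim
      case (elim s)
      then have "(\<Sum>k<n. p k * s ^ k) \<le> P s"
        using sum_le_suminf[OF sums_summable[OF P], of s "{..<n}"] sums_unique[OF P, of s] p(1) by simp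
      with elim show ?case by simp
    qed
  next
    fix y :: real assume "1 < y"
    show "\<forall>\<^sub>F s in at_left 1. P s < y"
      using ev
    proof eventually_elim
      case (elim s)
      then have "P s \<le> 1"
        using p(1) by (intro sums_le[OF _ P p(2)]) (auto intro!: mult_left_le power_le_one)
      with \<open>1 < y\<close> show ?case by simp
    qed
  qed
qed

theorem lemma2p1:
  shows "(\<forall>\<phi> :: real \<Rightarrow> real. is_laplace_transform \<phi> \<longrightarrow> is_pgf (\<lambda>s. \<phi> (1 - s))) \<and>
         (\<forall>(P :: real \<Rightarrow> real) (\<phi> :: real \<Rightarrow> real).
            is_pgf P \<and> completely_monotone \<phi> \<and> (\<forall>s\<in>{0<..<1}. \<phi> s = P (1 - s))
            \<longrightarrow> is_laplace_transform \<phi>)"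
proof (intro conjI allI impI)
  fix \<phi> :: "real \<Rightarrow> real"
  assume "is_laplace_transform \<phi>"
  then show "is_pgf (\<lambda>s. \<phi> (1 - s))" by (rule is_pgf_laplace_transform)
next
  fix P \<phi> :: "real \<Rightarrow> real"
  assume *: "is_pgf P \<and> completely_monotone \<phi> \<and> (\<forall>s\<in>{0<..<1}. \<phi> s = P (1 - s))"
  have "filterlim (\<lambda>s. 1 - s) (at_left 1) (at_right (0::real))"
    by real_asymp
  then have "((\<lambda>s. P (1 - s)) \<longlongrightarrow> 1) (at_right 0)"
    using * is_pgf_tendsto_1 filterlim_compose by blast
  \<comment> \<open>Agreement on the unit interval transfers the limit to the extension
    \<open>\<phi>\<close>.\<close>
  moreover have "\<forall>\<^sub>F s in at_right 0. P (1 - s) = \<phi> s"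
    using * eventually_at_right_real[of 0 "1::real"] by (auto elim!: eventually_mono)
  ultimately have "(\<phi> \<longlongrightarrow> 1) (at_right 0)"
    by (rule Lim_transform_eventually)
  with * show "is_laplace_transform \<phi>" by (intro bernstein) auto
qed

end
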